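(* Let $\alpha>0$, $\nu:=\alpha-1/2$, and let $z^{(\nu)}_k$, $k\in\mathbb{N}$, be the positive zeros of the Bessel function $J_\nu$ of the first kind. Then $$\sum_{k=1}^\infty\frac{1}{(z^{(\nu)}_k)^2}=\frac{1}{4(\nu+1)}.$$
   Context: The Bessel function of the first kind of order $\nu>-1$ is $J_\nu(x)=\sum_{k=0}^\infty\frac{(-1)^k}{k!\,\Gamma(k+\nu+1)}\big(\frac{x}{2}\big)^{2k+\nu}$, $x>0$; it has infinitely many positive zeros, all simple, listed increasingly as $0<z^{(\nu)}_1<z^{(\nu)}_2<\cdots$. *)

theory Defs
  imports "HOL-Analysis.Analysis"
begin

(* Only meaningful for nu > -1 and x > 0: there Gamma is evaluated at positive
   arguments and powr is the ordinary real power. *)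
definition bessel_J :: "real \<Rightarrow> real \<Rightarrow> real" where
  "bessel_J \<nu> x =
     (\<Sum>k. (-1) ^ k / (fact k * Gamma (real k + \<nu> + 1)) * (x / 2) powr (2 * real k + \<nu>))"

definition bessel_J_zeros :: "real \<Rightarrow> real set" where
  "bessel_J_zeros \<nu> = {x. 0 < x \<and> bessel_J \<nu> x = 0}"

(* The k-th positive zero in increasing order, indexed from k = 1: the zero z with
   exactly k positive zeros in (0, z].  For k > 0 the card condition forces that set
   to be finite; the value at k = 0 is junk. *)
definition bessel_J_zero :: "real \<Rightarrow> nat \<Rightarrow> real" where
  "bessel_J_zero \<nu> k =
     (THE z. z \<in> bessel_J_zeros \<nu> \<and> card {x \<in> bessel_J_zeros \<nu>. x \<le> z} = k)"

end

theory Submission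
  imports Defs "HOL-Complex_Analysis.Great_Picard" "HOL-Real_Asymp.Real_Asymp"
begin

text \<open>
  Up to elementary factors \<open>bessel_J \<nu> x\<close> is \<open>f (x\<^sup>2 / 4)\<close> with \<open>f\<close> the hypergeometric function
  \<open>0F1(; b; -w)\<close>, \<open>b = \<nu> + 1\<close>, and \<open>f\<close> is the limit of the rescaled Laguerre polynomials
  \<open>1F1(-n; b; w / n) = \<Prod>i<n. 1 - w * a n i\<close>. By Rolle's theorem these have \<open>n\<close> simple positive zeros,
  and the linear coefficient gives \<open>\<Sum>i<n. a n i = 1 / b\<close> for every \<open>n\<close>. The growth bound
  \<open>f (-y) \<le> exp (2 * sqrt y)\<close>, valid since \<open>b \<ge> 1 / 2\<close>, yields \<open>a n i \<le> C / (i + 1)\<^sup>2\<close> uniformly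
  in \<open>n\<close>. Hence along a subsequence \<open>a n i\<close> converges to some \<open>l i\<close> for every \<open>i\<close>, dominated convergence
  gives \<open>\<Sum>i. l i = 1 / b\<close>, and the zeros of \<open>f\<close> are exactly the numbers \<open>1 / l i\<close>, which are distinct
  because the zeros of \<open>f\<close> are simple.
\<close>

section \<open>Kummer polynomials: coefficients and differential identities\<close>

text \<open>The functions \<open>0F1(; b; -w)\<close> and \<open>1F1(-n; b; x)\<close>.\<close>

definition hyp01 :: "real \<Rightarrow> real \<Rightarrow> real" where
  "hyp01 b w = (\<Sum>k. (- w) ^ k / (fact k * pochhammer b k))"

definition kummer_poly :: "nat \<Rightarrow> real \<Rightarrow> real poly" where
  "kummer_poly n b = (\<Sum>i\<le>n. monom ((- 1) ^ i * real (n choose i) / pochhammer b i) i)"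

lemma coeff_kummer_poly:
  "coeff (kummer_poly n b) i = (- 1) ^ i * real (n choose i) / pochhammer b i"
  by (auto simp: kummer_poly_def coeff_sum if_distrib sum.delta binomial_eq_0)

lemma degree_kummer_poly_le: "degree (kummer_poly n b) \<le> n"
  by (rule degree_le) (auto simp: coeff_kummer_poly binomial_eq_0)

lemma poly_kummer_poly_0 [simp]: "poly (kummer_poly n b) 0 = 1"
  by (simp add: poly_0_coeff_0 coeff_kummer_poly)

lemma poly_kummer_poly:
  "poly (kummer_poly n b) x = (\<Sum>i\<le>n. real (n choose i) * (- x) ^ i / pochhammer b i)"
  by (simp add: kummer_poly_def poly_sum poly_monom power_minus[of x] mult_ac)

text \<open>Follows from \<open>(i + 1) * (n + 1 choose i + 1) = (n + 1) * (n choose i)\<close> and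
  \<open>pochhammer b (i + 1) = b * pochhammer (b + 1) i\<close>. Critical points are thus zeros of
  the family with parameter \<open>b + 1\<close>, which later excludes double zeros in the
  limit.\<close>

lemma pderiv_kummer_poly:
  assumes "b > 0"
  shows "pderiv (kummer_poly (Suc n) b) = smult (- (real (Suc n) / b)) (kummer_poly n (b + 1))"
proof (rule poly_eqI)
  fix i
  have "real (Suc i) * real (Suc n choose Suc i) = real (Suc n) * real (n choose i)"
    by (metis Suc_times_binomial of_nat_mult)
  then show "coeff (pderiv (kummer_poly (Suc n) b)) i =
      coeff (smult (- (real (Suc n) / b)) (kummer_poly n (b + 1))) i"
    by (simp add: coeff_pderiv coeff_kummer_poly pochhammer_rec divide_simps
        del: of_nat_Suc binomial_Suc_Suc)
qed

text \<open>Pascal's rule for the coefficients, because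
  \<open>(b + i) / pochhammer (b + 1) i = b / pochhammer b i\<close>. The left-hand side is
  \<open>x * q' + (b - x) * q\<close>, the combination for which
  \<open>x powr (b - 1) * exp (- x)\<close> is an integrating factor.\<close>

lemma kummer_poly_rec:
  assumes "b > 0"
  shows "pCons 0 (pderiv (kummer_poly n (b + 1))) + [:b, -1:] * kummer_poly n (b + 1) =
    smult b (kummer_poly (Suc n) b)"
proof (rule poly_eqI)
  fix i
  show "coeff (pCons 0 (pderiv (kummer_poly n (b + 1))) + [:b, -1:] * kummer_poly n (b + 1)) i =
    coeff (smult b (kummer_poly (Suc n) b)) i"
  proof (cases i)
    case 0
    then show ?thesis by (simp add: coeff_kummer_poly)
  next
    case (Suc j)
    have p: "pochhammer (b + 1) j > 0" using assms by (intro pochhammer_pos) auto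
    have 1: "pochhammer (b + 1) (Suc j) = pochhammer (b + 1) j * (b + 1 + j)"
      by (simp add: pochhammer_rec')
    have 2: "pochhammer b (Suc j) = b * pochhammer (b + 1) j"
      by (simp add: pochhammer_rec)
    have nz: "b + 1 + j \<noteq> 0" "b \<noteq> 0" using assms by auto
    show ?thesis using p nz
      by (simp add: Suc coeff_pderiv coeff_kummer_poly 1 2 coeff_pCons divide_simps)
        (simp add: algebra_simps)
  qed
qed

text \<open>A Rodrigues-type formula: \<open>kummer_poly_rec\<close> times the integrating factor is
  an exact derivative. Rolle's theorem for the weighted polynomial of degree at most
  \<open>n\<close> then yields zeros of the next polynomial.\<close>

lemma kummer_poly_weighted_deriv:
  assumes "b > 0" "x > 0"
  shows "((\<lambda>x. x powr b * exp (- x) * poly (kummer_poly n (b + 1)) x) has_real_derivative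
    b * x powr (b - 1) * exp (- x) * poly (kummer_poly (Suc n) b) x) (at x)"
proof -
  let ?q = "kummer_poly n (b + 1)"
  have "b * poly (kummer_poly (Suc n) b) x = x * poly (pderiv ?q) x + (b - x) * poly ?q x"
    using arg_cong[OF kummer_poly_rec[OF assms(1), of n], of "\<lambda>p. poly p x"]
    by (simp add: algebra_simps)
  then have "b * x powr (b - 1) * exp (- x) * poly (kummer_poly (Suc n) b) x =
      x powr (b - 1) * exp (- x) * (x * poly (pderiv ?q) x + (b - x) * poly ?q x)"
    by (simp flip: \<open>b * _ = _\<close>)
  also have "\<dots> = b * x powr (b - 1) * (exp (- x) * poly ?q x) +
      (x * x powr (b - 1)) * (- exp (- x) * poly ?q x + exp (- x) * poly (pderiv ?q) x)"
    by (simp add: algebra_simps)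
  also have "x * x powr (b - 1) = x powr b"
    using assms by (simp add: powr_mult_base)
  finally have eq: "b * x powr (b - 1) * exp (- x) * poly (kummer_poly (Suc n) b) x =
      b * x powr (b - 1) * (exp (- x) * poly ?q x) +
      x powr b * (- exp (- x) * poly ?q x + exp (- x) * poly (pderiv ?q) x)" .
  have "((\<lambda>x. exp (- x) * poly ?q x) has_real_derivative
      - exp (- x) * poly ?q x + exp (- x) * poly (pderiv ?q) x) (at x)"
    by (auto intro!: derivative_eq_intros)
  from DERIV_mult[OF has_real_derivative_powr[OF assms(2), of b] this] show ?thesis
    unfolding eq by (simp add: mult_ac add_ac)
qed

section \<open>Positive zeros of the Kummer polynomials and factorization\<close>

text \<open>
  Rolle's theorem, on the bounded gaps between consecutive zeros and on the last, unbounded one.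
\<close>
lemma kummer_poly_roots:
  assumes "b > 0"
  shows "\<exists>t. t 0 = 0 \<and> (\<forall>i<n. t i < t (Suc i) \<and> poly (kummer_poly n b) (t (Suc i)) = 0)"
  using assms
proof (induction n arbitrary: b)
  case 0
  show ?case by auto
next
  case (Suc n)
  let ?q = "kummer_poly n (b + 1)" and ?Q = "kummer_poly (Suc n) b"
  from Suc.IH[of "b + 1"] Suc.prems obtain t where t0: "t 0 = 0"
    and t: "\<And>i. i < n \<Longrightarrow> t i < t (Suc i)" "\<And>i. i < n \<Longrightarrow> poly ?q (t (Suc i)) = 0"
    by auto
  \<comment> \<open>Since \<open>b > 0\<close>, the weight makes \<open>h\<close> vanish at
    \<open>t 0 = 0\<close> as well, so there are \<open>n\<close> bounded gaps between zeros of
    \<open>h\<close>, although \<open>0\<close> is not a zero of the polynomial.\<close>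
  define h where "h x = x powr b * exp (- x) * poly ?q x" for x
  define h' where "h' x = b * x powr (b - 1) * exp (- x) * poly ?Q x" for x
  have deriv: "(h has_real_derivative h' x) (at x)" if "x > 0" for x
    unfolding h_def h'_def by (rule kummer_poly_weighted_deriv) (use that Suc.prems in auto)
  have h'0: "poly ?Q x = 0" if "h' x = 0" "x > 0" for x
    using that Suc.prems by (simp add: h'_def)
  have contq: "continuous_on {0..} h" unfolding h_def
    using Suc.prems by (intro continuous_intros continuous_on_powr') auto
  have tnn: "0 \<le> t i" if "i \<le> n" for i
    using that by (induction i) (use t0 t in \<open>auto simp: less_imp_le order.trans[OF _ less_imp_le]\<close>)
  have ht: "h (t i) = 0" if "i \<le> n" for i
    using that t0 t(2) by (cases i) (auto simp: h_def)
  have mid: "\<exists>r. t i < r \<and> r < t (Suc i) \<and> poly ?Q r = 0" if "i < n" for i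
  proof -
    have "\<exists>r>t i. r < t (Suc i) \<and> (*) (h' r) = (\<lambda>v. 0)"
    proof (rule Rolle_deriv[of _ _ h])
      show "continuous_on {t i..t (Suc i)} h"
        by (rule continuous_on_subset[OF contq]) (use tnn[of i] that in auto)
      show "(h has_derivative (*) (h' x)) (at x)" if "t i < x" for x
        using deriv[of x] tnn[of i] that \<open>i < n\<close> by (simp add: has_field_derivative_def)
    qed (use that t ht in auto)
    then obtain r where "t i < r" "r < t (Suc i)" "h' r * 1 = 0" by metis
    then show ?thesis using h'0[of r] tnn[of i] that by auto
  qed
  \<comment> \<open>On the unbounded gap \<open>h\<close> starts at 0, is nonzero at some
    \<open>m\<close> and decays to 0, so it takes some value twice and Rolle's theorem applies once
    more.\<close>
  have last: "\<exists>r>t n. poly ?Q r = 0"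
  proof -
    have lim: "(h \<longlongrightarrow> 0) at_top"
    proof -
      have "((\<lambda>x. \<Sum>i\<le>degree ?q. coeff ?q i * (x powr b * exp (- x) * x ^ i)) \<longlongrightarrow>
          (\<Sum>i\<le>degree ?q. coeff ?q i * 0)) at_top"
      proof (intro tendsto_sum tendsto_mult tendsto_const)
        fix i
        show "((\<lambda>x. x powr b * exp (- x) * x ^ i) \<longlongrightarrow> 0) at_top"
          by real_asymp
      qed
      then show ?thesis
        by (simp add: h_def[abs_def] poly_altdef sum_distrib_left mult_ac)
    qed
    obtain m where m: "m > t n" "h m \<noteq> 0"
    proof -
      have "finite {x. poly ?q x = 0}"
        by (rule poly_roots_finite) (metis poly_kummer_poly_0 poly_0 zero_neq_one)
      then have "infinite ({t n<..} - {x. poly ?q x = 0})"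
        by (simp add: infinite_Ioi Diff_infinite_finite)
      then have "{t n<..} - {x. poly ?q x = 0} \<noteq> {}"
        by (metis finite.emptyI)
      then obtain m where "m > t n" "poly ?q m \<noteq> 0" by auto
      then show ?thesis using that tnn[of n] by (force simp: h_def)
    qed
    obtain y u where yu: "t n \<le> u" "u < y" "h u = h y"
    proof -
      have "eventually (\<lambda>x. \<bar>h x\<bar> < \<bar>h m\<bar> \<and> x > m) at_top"
        using m(2) tendstoD[OF lim, of "\<bar>h m\<bar>"] by (auto intro: eventually_conj eventually_gt_at_top)
      then obtain y where y: "\<bar>h y\<bar> < \<bar>h m\<bar>" "y > m"
        using eventually_happens trivial_limit_at_top_linorder by blast
      \<comment> \<open>Stated for \<open>g\<close> so as to serve both \<open>h\<close> and
        \<open>- h\<close>. If \<open>g y\<close> is nonnegative, its value already occurs on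
        \<open>[t n, m]\<close>; otherwise \<open>g\<close> has a zero in \<open>[m, y]\<close>,
        which repeats the value at \<open>t n\<close>.\<close>
      have key: "\<exists>u v. t n \<le> u \<and> u < v \<and> g u = g v"
        if g: "continuous_on {0..} g" "g (t n) = 0" "\<bar>g y\<bar> < g m" for g :: "real \<Rightarrow> real"
      proof -
        have c: "continuous_on {t n..m} g" "continuous_on {m..y} g"
          using tnn[of n] m(1) by (auto intro!: continuous_on_subset[OF g(1)])
        show ?thesis
        proof (cases "g y \<ge> 0")
          case True
          then obtain u where "t n \<le> u" "u \<le> m" "g u = g y"
            using IVT'[of g "t n" "g y" m] c m(1) g by auto
          then show ?thesis using y by (intro exI[of _ u] exI[of _ y]) auto
        next
          case False
          then obtain v where "m \<le> v" "v \<le> y" "g v = 0"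
            using IVT2'[of g y 0 m] c y g by auto
          then show ?thesis using m g by (intro exI[of _ "t n"] exI[of _ v]) auto
        qed
      qed
      have "\<exists>u v. t n \<le> u \<and> u < v \<and> h u = h v"
      proof (cases "h m > 0")
        case True
        then show ?thesis using key[of h] contq ht[of n] y by auto
      next
        case False
        then show ?thesis
          using key[of "\<lambda>x. - h x"] contq ht[of n] y by (auto intro: continuous_intros)
      qed
      then show ?thesis using that by blast
    qed
    have "\<exists>r>u. r < y \<and> (*) (h' r) = (\<lambda>v. 0)"
    proof (rule Rolle_deriv[of _ _ h])
      show "continuous_on {u..y} h"
        by (rule continuous_on_subset[OF contq]) (use tnn[of n] yu in auto)
      show "(h has_derivative (*) (h' x)) (at x)" if "u < x" for x
        using deriv[of x] tnn[of n] that yu by (simp add: has_field_derivative_def)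
    qed (use yu in auto)
    then obtain r where "u < r" "r < y" "h' r * 1 = 0" by metis
    then show ?thesis using h'0[of r] tnn[of n] yu by (intro exI[of _ r]) auto
  qed
  from mid last obtain r where r: "\<And>i. i < n \<Longrightarrow> t i < r i \<and> r i < t (Suc i) \<and> poly ?Q (r i) = 0"
    and rn: "r n > t n" "poly ?Q (r n) = 0"
  proof -
    have "\<forall>i\<le>n. \<exists>r. t i < r \<and> (i < n \<longrightarrow> r < t (Suc i)) \<and> poly ?Q r = 0"
      using mid last by (metis le_neq_implies_less)
    then obtain r where "\<forall>i\<le>n. t i < r i \<and> (i < n \<longrightarrow> r i < t (Suc i)) \<and> poly ?Q (r i) = 0"
      using choice[of "\<lambda>i r. i \<le> n \<longrightarrow> t i < r \<and> (i < n \<longrightarrow> r < t (Suc i)) \<and> poly ?Q r = 0"] by blast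
    then show ?thesis using that[of r] by auto
  qed
  define s where "s i = (case i of 0 \<Rightarrow> 0 | Suc j \<Rightarrow> r j)" for i
  have "s i < s (Suc i) \<and> poly ?Q (s (Suc i)) = 0" if "i < Suc n" for i
  proof (cases i)
    case 0
    then show ?thesis using r[of 0] rn t0 by (cases n) (auto simp: s_def)
  next
    case (Suc j)
    then show ?thesis using r[of j] r[of i] rn that by (cases "i = n") (auto simp: s_def)
  qed
  then show ?case by (intro exI[of _ s]) (simp add: s_def)
qed


lemma coeff_1_prod_linear:
  fixes c :: "nat \<Rightarrow> 'a :: comm_ring_1"
  shows "coeff (\<Prod>i<n. [:1, - c i:]) 1 = - (\<Sum>i<n. c i)"
proof (induction n)
  case (Suc n)
  have "coeff (\<Prod>i<n. [:1, - c i:]) 0 = 1"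
    by (simp flip: poly_0_coeff_0 add: poly_prod)
  then show ?case using Suc by (simp add: coeff_pCons)
qed auto

text \<open>Both sides have degree at most \<open>n\<close> and agree at \<open>n + 1\<close>
  points: the \<open>n\<close> positive zeros, and 0, where both equal 1. The \<open>c i\<close> are
  the reciprocals of the zeros, and the linear coefficient gives their sum.\<close>

lemma kummer_poly_factor:
  assumes "b > 0"
  obtains c :: "nat \<Rightarrow> real" where
    "\<And>i. i < n \<Longrightarrow> c i > 0" "\<And>i. i \<ge> n \<Longrightarrow> c i = 0" "\<And>i. Suc i < n \<Longrightarrow> c (Suc i) < c i"
    "\<And>x. poly (kummer_poly n b) x = (\<Prod>i<n. 1 - x * c i)" "(\<Sum>i<n. c i) = real n / b"
proof -
  from kummer_poly_roots[OF assms, of n] obtain t where t0: "t 0 = 0"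
    and t: "\<And>i. i < n \<Longrightarrow> t i < t (Suc i)" "\<And>i. i < n \<Longrightarrow> poly (kummer_poly n b) (t (Suc i)) = 0"
    by auto
  have mono: "i < j \<Longrightarrow> j \<le> n \<Longrightarrow> t i < t j" for i j
  proof (induction j)
    case (Suc j)
    then show ?case using t(1)[of j] by (cases "i = j") auto
  qed simp
  have pos: "t (Suc i) > 0" if "i < n" for i using mono[of 0 "Suc i"] that t0 by auto
  define c where "c i = (if i < n then 1 / t (Suc i) else 0)" for i
  define P where "P = (\<Prod>i<n. [:1, - c i:])"
  have "kummer_poly n b = P"
  proof (rule poly_eqI_degree[where A = "t ` {..n}"])
    have "inj_on t {..n}"
      by (rule linorder_inj_onI) (use mono in force)+
    then have card: "card (t ` {..n}) = Suc n" by (simp add: card_image)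
    then show "degree (kummer_poly n b) < card (t ` {..n})"
      using degree_kummer_poly_le[of n b] by simp
    have "degree P \<le> (\<Sum>i<n. degree [:1, - c i:])"
      unfolding P_def using degree_prod_sum_le[of "{..<n}" "\<lambda>i. [:1, - c i:]"] by (simp add: o_def)
    also have "\<dots> \<le> (\<Sum>i<n. 1)" by (intro sum_mono) simp
    finally show "degree P < card (t ` {..n})" using card by simp
    fix x assume "x \<in> t ` {..n}"
    then obtain i where i: "i \<le> n" "x = t i" by auto
    show "poly (kummer_poly n b) x = poly P x"
    proof (cases i)
      case 0
      then show ?thesis using i t0 by (simp add: P_def poly_prod)
    next
      case (Suc j)
      then have "\<exists>a\<in>{..<n}. 1 - x * c a = 0"
        using i pos[of j] by (intro bexI[of _ j]) (auto simp: c_def)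
      then have "poly P x = 0" by (simp add: P_def poly_prod algebra_simps)
      then show ?thesis using t i Suc by simp
    qed
  qed
  moreover have "poly P x = (\<Prod>i<n. 1 - x * c i)" for x
    by (simp add: P_def poly_prod algebra_simps)
  moreover have "(\<Sum>i<n. c i) = - coeff P 1"
    by (simp only: P_def coeff_1_prod_linear minus_minus)
  moreover have "- coeff (kummer_poly n b) 1 = real n / b"
    by (simp add: coeff_kummer_poly)
  ultimately show ?thesis
    using that[of c] pos mono by (auto simp: c_def frac_less2)
qed

section \<open>Growth bounds and the limit of the rescaled polynomials\<close>

text \<open>Equality holds at \<open>b = 1 / 2\<close> by the duplication formula, and
  \<open>pochhammer b k\<close> increases with \<open>b\<close>. This makes the series of
  \<open>cosh\<close> a majorant.\<close>

lemma fact_pochhammer_ge: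
  fixes b :: real
  assumes "b \<ge> 1 / 2"
  shows "fact (2 * k) / 4 ^ k \<le> fact k * pochhammer b k"
proof -
  have "pochhammer (2 * (1 / 2)) (2 * k) = (of_nat (2 ^ (2 * k)) * pochhammer (1 / 2) k * pochhammer (1 / 2 + 1 / 2) k :: real)"
    by (rule pochhammer_double)
  then have "(fact (2 * k) :: real) = 4 ^ k * pochhammer (1 / 2) k * fact k"
    by (simp add: pochhammer_fact power_mult)
  moreover have "pochhammer (1 / 2) k \<le> pochhammer b k"
    unfolding pochhammer_prod by (rule prod_mono) (use assms in auto)
  ultimately show ?thesis by (simp add: mult_left_mono mult_ac)
qed

lemma hyp01_term_le:
  fixes b w y :: real
  assumes "b \<ge> 1 / 2" "\<bar>w\<bar> \<le> y"
  shows "\<bar>w\<bar> ^ k / (fact k * pochhammer b k) \<le> (4 * y) ^ k / fact (2 * k)"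
proof -
  have "\<bar>w\<bar> ^ k / (fact k * pochhammer b k) \<le> y ^ k / (fact (2 * k) / 4 ^ k)"
    using assms by (intro frac_le power_mono fact_pochhammer_ge) auto
  then show ?thesis by (simp add: power_mult_distrib mult_ac)
qed

lemma sums_cosh_sqrt:
  fixes y :: real
  assumes "y \<ge> 0"
  shows "(\<lambda>k. (4 * y) ^ k / fact (2 * k)) sums cosh (2 * sqrt y)"
proof -
  let ?f = "\<lambda>n. if even n then (2 * sqrt y) ^ n /\<^sub>R fact n else 0"
  have "(\<lambda>k. ?f (2 * k)) sums cosh (2 * sqrt y)"
    by (subst sums_mono_reindex[of "\<lambda>k. 2 * k" ?f])
      (auto simp: strict_mono_def cosh_converges elim!: evenE)
  moreover have "(2 * sqrt y) ^ (2 * k) = (4 * y) ^ k" for k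
    using assms by (simp add: power_mult power_mult_distrib)
  ultimately show ?thesis by (simp add: divide_inverse mult_ac)
qed

lemma summable_hyp01:
  fixes b w :: real
  assumes "b \<ge> 1 / 2"
  shows "summable (\<lambda>k. (- w) ^ k / (fact k * pochhammer b k))"
proof (rule summable_comparison_test')
  show "summable (\<lambda>k. (4 * \<bar>w\<bar>) ^ k / fact (2 * k))"
    using sums_cosh_sqrt[of "\<bar>w\<bar>"] by (simp add: sums_iff)
  show "norm ((- w) ^ k / (fact k * pochhammer b k)) \<le> (4 * \<bar>w\<bar>) ^ k / fact (2 * k)" for k
    using hyp01_term_le[OF assms, of w "\<bar>w\<bar>" k] pochhammer_pos[of b k] assms
    by (simp add: power_abs abs_mult)
qed

lemma binomial_mult_power_le:
  fixes x :: real
  shows "\<bar>real (n choose k) * (- x) ^ k\<bar> \<le> \<bar>real n * x\<bar> ^ k / fact k"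
proof -
  have "real ((n choose k) * fact k) \<le> real (n ^ k)"
    by (simp only: of_nat_le_iff binomial_fact_pow)
  then have "real (n choose k) \<le> real n ^ k / fact k" by (simp add: field_simps)
  then have "real (n choose k) * \<bar>x\<bar> ^ k \<le> real n ^ k / fact k * \<bar>x\<bar> ^ k"
    by (rule mult_right_mono) auto
  then show ?thesis by (simp add: abs_mult power_abs power_mult_distrib)
qed

text \<open>By \<open>(n choose k) \<le> n ^ k / fact k\<close> each term is dominated by the
  corresponding term of \<open>hyp01\<close>, so the majorant depends on \<open>n\<close> and
  \<open>x\<close> only through the bound \<open>y\<close> on their product.\<close>

lemma kummer_term_le:
  fixes b x y :: real
  assumes "b \<ge> 1 / 2" "\<bar>real n * x\<bar> \<le> y"
  shows "\<bar>real (n choose k) * (- x) ^ k / pochhammer b k\<bar> \<le> (4 * y) ^ k / fact (2 * k)"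
proof -
  have p: "pochhammer b k > 0" using assms by (intro pochhammer_pos) auto
  have "\<bar>real (n choose k) * (- x) ^ k\<bar> / pochhammer b k \<le> \<bar>real n * x\<bar> ^ k / fact k / pochhammer b k"
    using binomial_mult_power_le[of n k x] p by (intro divide_right_mono) auto
  also have "\<dots> \<le> (4 * y) ^ k / fact (2 * k)"
    using hyp01_term_le[OF assms] by simp
  finally show ?thesis using p by simp
qed

lemma poly_kummer_poly_le_exp:
  assumes "b \<ge> 1 / 2" "y \<ge> 0"
  shows "poly (kummer_poly n b) (- (y / real n)) \<le> exp (2 * sqrt y)"
proof -
  have "poly (kummer_poly n b) (- (y / real n)) \<le> (\<Sum>k\<le>n. (4 * y) ^ k / fact (2 * k))"
    unfolding poly_kummer_poly
  proof (rule sum_mono)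
    fix k
    \<comment> \<open>An inequality, because for \<open>n = 0\<close> the quotient is 0 by
      convention.\<close>
    have "\<bar>real n * - (y / real n)\<bar> \<le> y" using assms by auto
    from kummer_term_le[OF assms(1) this, of k]
    show "real (n choose k) * (- (- (y / real n))) ^ k / pochhammer b k \<le> (4 * y) ^ k / fact (2 * k)"
      by linarith
  qed
  also have "\<dots> \<le> (\<Sum>k. (4 * y) ^ k / fact (2 * k))"
    using sums_cosh_sqrt[of y] assms by (intro sum_le_suminf) (auto simp: sums_iff)
  also have "\<dots> = cosh (2 * sqrt y)" using sums_cosh_sqrt[of y] assms by (simp add: sums_iff)
  also have "\<dots> \<le> exp (2 * sqrt y)" using assms by (simp add: cosh_def)
  finally show ?thesis .
qed

lemma binomial_div_power_tendsto:
  "(\<lambda>n. real (n choose k) / real n ^ k) \<longlonglongrightarrow> 1 / fact k"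
proof (induction k)
  case (Suc k)
  have "(\<lambda>n. (real n - real k) / real n) \<longlonglongrightarrow> 1" by real_asymp
  then have "(\<lambda>n. real (n choose k) / real n ^ k * ((real n - real k) / real n / real (Suc k)))
      \<longlonglongrightarrow> 1 / fact k * (1 / real (Suc k))"
    by (intro tendsto_intros Suc.IH) auto
  moreover have "eventually (\<lambda>n. real (n choose k) / real n ^ k * ((real n - real k) / real n / real (Suc k)) =
      real (n choose Suc k) / real n ^ Suc k) at_top"
    using eventually_gt_at_top[of k]
  proof eventually_elim
    case (elim n)
    have "Suc k * (n choose Suc k) = (n - k) * (n choose k)"
      by (metis binomial_absorb_comp binomial_absorption)
    then have "real (Suc k) * real (n choose Suc k) = (real n - real k) * real (n choose k)"
      using elim by (metis of_nat_mult of_nat_diff less_imp_le)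
    then have "real (n choose Suc k) = (real n - real k) * real (n choose k) / real (Suc k)"
      by (simp add: field_simps del: of_nat_Suc)
    then show ?case by (simp del: of_nat_Suc add: mult_ac)
  qed
  ultimately have "(\<lambda>n. real (n choose Suc k) / real n ^ Suc k) \<longlonglongrightarrow> 1 / fact k * (1 / real (Suc k))"
    by (rule Lim_transform_eventually)
  then show ?case by (simp del: of_nat_Suc add: mult_ac)
qed simp

text \<open>Tannery's theorem with the \<open>cosh\<close> majorant. The points \<open>x m\<close>
  may move with the degree, so that the limit can be taken along zeros of the polynomials.\<close>

lemma poly_kummer_poly_tendsto:
  assumes "b \<ge> 1 / 2" and N: "filterlim N at_top sequentially"
    and x: "(\<lambda>m. real (N m) * x m) \<longlonglongrightarrow> w"
  shows "(\<lambda>m. poly (kummer_poly (N m) b) (x m)) \<longlonglongrightarrow> hyp01 b w"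
proof -
  define a where "a k m = real (N m choose k) * (- x m) ^ k / pochhammer b k" for k m
  from convergent_imp_Bseq[OF convergentI[OF x]] obtain B where B: "\<And>m. \<bar>real (N m) * x m\<bar> \<le> B"
    unfolding Bseq_def by auto
  then have "B \<ge> 0" by (metis abs_ge_zero order.trans)
  have "((\<lambda>m. suminf (\<lambda>k. a k m)) \<longlonglongrightarrow> (\<Sum>k. (- w) ^ k / (fact k * pochhammer b k)))"
  proof (rule conjunct2[OF conjunct2[OF tannerys_theorem[where M = "\<lambda>k. (4 * B) ^ k / fact (2 * k)"]]])
    fix k
    have "(\<lambda>m. real (N m choose k) / real (N m) ^ k * (- (real (N m) * x m)) ^ k / pochhammer b k)
        \<longlonglongrightarrow> 1 / fact k * (- w) ^ k / pochhammer b k"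
      using assms pochhammer_pos[of b k]
      by (intro tendsto_intros x filterlim_compose[OF binomial_div_power_tendsto N]) auto
    moreover have "eventually (\<lambda>m. real (N m choose k) / real (N m) ^ k * (- (real (N m) * x m)) ^ k / pochhammer b k = a k m) sequentially"
      using eventually_compose_filterlim[OF eventually_gt_at_top[of 0] N]
      by eventually_elim (simp add: a_def power_mult_distrib power_minus[of "_ * _"] power_minus[of "x _"])
    ultimately show "a k \<longlonglongrightarrow> (- w) ^ k / (fact k * pochhammer b k)"
      by (auto dest: Lim_transform_eventually)
  next
    show "eventually (\<lambda>(k, m). norm (a k m) \<le> (4 * B) ^ k / fact (2 * k)) (at_top \<times>\<^sub>F sequentially)"
      using kummer_term_le[OF assms(1) B] by (intro always_eventually) (auto simp: a_def)
    show "summable (\<lambda>k. (4 * B) ^ k / fact (2 * k))"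
      using sums_cosh_sqrt[OF \<open>B \<ge> 0\<close>] by (simp add: sums_iff)
  qed auto
  moreover have "suminf (\<lambda>k. a k m) = poly (kummer_poly (N m) b) (x m)" for m
    unfolding poly_kummer_poly a_def by (rule suminf_finite) (auto simp: binomial_eq_0)
  ultimately show ?thesis by (simp add: hyp01_def)
qed

text \<open>Weierstrass' product inequality; it later keeps the tail of a product away from
  0.\<close>

lemma prod_1_minus_ge:
  fixes x :: "'i \<Rightarrow> real"
  assumes "finite I" "\<And>i. i \<in> I \<Longrightarrow> 0 \<le> x i \<and> x i \<le> 1"
  shows "1 - (\<Sum>i\<in>I. x i) \<le> (\<Prod>i\<in>I. 1 - x i)"
  using assms
proof (induction I rule: finite_induct)
  case (insert j I)
  let ?P = "\<Prod>i\<in>I. 1 - x i"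
  have "x j * ?P \<le> x j * 1"
    using insert.prems by (intro mult_left_mono prod_le_1) auto
  moreover have "1 - (\<Sum>i\<in>I. x i) \<le> ?P"
    using insert by auto
  ultimately show ?case using insert.hyps by (simp add: algebra_simps)
qed simp

section \<open>Contiguous relation and absence of common zeros\<close>

text \<open>The Bessel recurrence linking three consecutive orders. The constant terms cancel; in
  the term of index \<open>k + 1\<close> the difference leaves the factor
  \<open>(b + k + 1) - b = k + 1\<close>, which cancels against the factorial.\<close>

lemma hyp01_contiguous:
  assumes "b \<ge> 1 / 2"
  shows "hyp01 b w - hyp01 (b + 1) w = - w / (b * (b + 1)) * hyp01 (b + 2) w"
proof -
  define f where "f k = (- w) ^ k / (fact k * pochhammer b k) - (- w) ^ k / (fact k * pochhammer (b + 1) k)" for k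
  have s: "summable (\<lambda>k. (- w) ^ k / (fact k * pochhammer c k))" if "c \<ge> b" for c
    by (rule summable_hyp01) (use assms that in auto)
  have f: "f (Suc k) = - w / (b * (b + 1)) * ((- w) ^ k / (fact k * pochhammer (b + 2) k))" for k
  proof -
    have p: "pochhammer (b + 2) k > 0" using assms by (intro pochhammer_pos) auto
    have 2: "pochhammer (b + 1) (Suc k) = (b + 1) * pochhammer (b + 2) k"
      using pochhammer_rec[of "b + 1" k] by (simp only: add.assoc one_add_one)
    have "pochhammer b (Suc k) * (b + real (Suc k)) = pochhammer b (Suc (Suc k))"
      by (simp only: pochhammer_rec' mult.commute)
    also have "\<dots> = b * pochhammer (b + 1) (Suc k)" by (simp only: pochhammer_rec)
    finally have 1: "pochhammer b (Suc k) = b * ((b + 1) * pochhammer (b + 2) k) / (b + real (Suc k))"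
      using assms unfolding 2 by (simp add: field_simps del: pochhammer_Suc)
    have nz: "b \<noteq> 0" "b + 1 \<noteq> 0" "b + real (Suc k) \<noteq> 0" "real (Suc k) \<noteq> 0" using assms by auto
    have "f (Suc k) = - w * (- w) ^ k / (real (Suc k) * fact k * (b * ((b + 1) * pochhammer (b + 2) k))) * ((b + real (Suc k)) - b)"
      unfolding f_def 1 2 using nz p by (simp add: divide_simps del: of_nat_Suc) (simp add: algebra_simps)
    also have "\<dots> = - w / (b * (b + 1)) * ((- w) ^ k / (fact k * pochhammer (b + 2) k))"
      using nz p by (simp add: divide_simps)
    finally show ?thesis .
  qed
  have "hyp01 b w - hyp01 (b + 1) w = (\<Sum>k. f k)"
    unfolding hyp01_def f_def by (intro suminf_diff s) auto
  also have "\<dots> = (\<Sum>k. f (Suc k)) + f 0"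
    using suminf_split_head[of f] summable_diff[OF s[of b] s[of "b + 1"]] by (simp add: f_def[abs_def])
  also have "\<dots> = - w / (b * (b + 1)) * hyp01 (b + 2) w"
    unfolding f hyp01_def using suminf_mult[OF s[of "b + 2"], of "- w / (b * (b + 1))"] by (simp add: f_def)
  finally show ?thesis .
qed

text \<open>As the parameter grows, every term except the constant one tends to 0, under a majorant
  that does not depend on the parameter.\<close>

lemma hyp01_tendsto_1:
  assumes "b \<ge> 1 / 2"
  shows "(\<lambda>m. hyp01 (b + real m) w) \<longlonglongrightarrow> 1"
proof -
  \<comment> \<open>The factor \<open>0 ^ k\<close> is 1 for \<open>k = 0\<close> and 0 otherwise,
    which covers both cases of the termwise limit.\<close>
  have "(\<lambda>m. \<Sum>k. (- w) ^ k / (fact k * pochhammer (b + real m) k)) \<longlonglongrightarrow> (\<Sum>k. (- w) ^ k / fact k * 0 ^ k)"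
  proof (rule conjunct2[OF conjunct2[OF tannerys_theorem[where M = "\<lambda>k. (4 * \<bar>w\<bar>) ^ k / fact (2 * k)"]]])
    fix k
    have "(\<lambda>m. \<Prod>i<k. 1 / (b + real m + real i)) \<longlonglongrightarrow> (\<Prod>i<k. 0)"
      by (intro tendsto_prod) real_asymp
    then have "(\<lambda>m. (- w) ^ k / fact k * (\<Prod>i<k. 1 / (b + real m + real i))) \<longlonglongrightarrow> (- w) ^ k / fact k * 0 ^ k"
      by (intro tendsto_mult tendsto_const) auto
    then show "(\<lambda>m. (- w) ^ k / (fact k * pochhammer (b + real m) k)) \<longlonglongrightarrow> (- w) ^ k / fact k * 0 ^ k"
      by (simp add: pochhammer_prod prod_dividef lessThan_atLeast0)
  next
    have "\<bar>(- w) ^ k / (fact k * pochhammer (b + real m) k)\<bar> \<le> (4 * \<bar>w\<bar>) ^ k / fact (2 * k)" for k m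
      using hyp01_term_le[of "b + real m" w "\<bar>w\<bar>" k] pochhammer_pos[of "b + real m" k] assms
      by (simp add: power_abs abs_mult)
    then show "eventually (\<lambda>(k, m). norm ((- w) ^ k / (fact k * pochhammer (b + real m) k)) \<le> (4 * \<bar>w\<bar>) ^ k / fact (2 * k))
        (at_top \<times>\<^sub>F sequentially)"
      by (intro always_eventually) auto
    show "summable (\<lambda>k. (4 * \<bar>w\<bar>) ^ k / fact (2 * k))"
      using sums_cosh_sqrt[of "\<bar>w\<bar>"] by (simp add: sums_iff)
  qed auto
  moreover have "(\<Sum>k. (- w) ^ k / fact k * 0 ^ k) = 1"
    using powser_zero[of "\<lambda>k. (- w) ^ k / fact k"] by simp
  ultimately show ?thesis by (simp add: hyp01_def)
qed

text \<open>Since \<open>w\<close> is nonzero, the contiguous relation carries a common zero on to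
  all parameters \<open>b + m\<close>, against the limit 1.\<close>

lemma hyp01_no_common_zero:
  assumes "b \<ge> 1 / 2" "w > 0" "hyp01 b w = 0"
  shows "hyp01 (b + 1) w \<noteq> 0"
proof
  assume 0: "hyp01 (b + 1) w = 0"
  have "hyp01 (b + real m) w = 0 \<and> hyp01 (b + real m + 1) w = 0" for m
  proof (induction m)
    case (Suc m)
    then show ?case
      using hyp01_contiguous[of "b + real m" w] assms by (simp add: add_ac)
  qed (use 0 assms in auto)
  then have "(\<lambda>m. hyp01 (b + real m) w) \<longlonglongrightarrow> 0" by simp
  with hyp01_tendsto_1[OF assms(1), of w] show False
    using LIMSEQ_unique zero_neq_one by metis
qed

section \<open>Uniform decay of the reciprocal zeros\<close>

text \<open>
  At \<open>y = 1 / a n i\<close> the first \<open>i + 1\<close> factors of \<open>\<Prod>j<n. 1 + y * a n j\<close> are at least 2, while the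
  whole product grows only like \<open>exp (2 * sqrt y)\<close>. The resulting quadratic decay is what
  prevents mass of the sum \<open>\<Sum>i<n. a n i\<close> from escaping to infinity.
\<close>
lemma kummer_reciprocal_zeros:
  assumes "b \<ge> 1 / 2"
  obtains a :: "nat \<Rightarrow> nat \<Rightarrow> real" where
    "\<And>n i. i < n \<Longrightarrow> a n i > 0" "\<And>n i. i \<ge> n \<Longrightarrow> a n i = 0"
    "\<And>n i. Suc i < n \<Longrightarrow> a n (Suc i) < a n i"
    "\<And>n w. poly (kummer_poly n b) (w / real n) = (\<Prod>i<n. 1 - w * a n i)"
    "\<And>n. n > 0 \<Longrightarrow> (\<Sum>i<n. a n i) = 1 / b"
    "\<And>n i. a n i \<le> (2 / ln 2)\<^sup>2 * (1 / (real i + 1)\<^sup>2)"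
proof -
  have "b > 0" using assms by simp
  have "\<exists>c. (\<forall>i<n. c i > 0) \<and> (\<forall>i\<ge>n. c i = 0) \<and> (\<forall>i. Suc i < n \<longrightarrow> c (Suc i) < c i) \<and>
      (\<forall>x. poly (kummer_poly n b) x = (\<Prod>i<n. 1 - x * c i)) \<and> (\<Sum>i<n. c i) = real n / b" for n
    using kummer_poly_factor[OF \<open>b > 0\<close>, of n] by metis
  then obtain c where c: "\<And>n i. i < n \<Longrightarrow> c n i > (0::real)" "\<And>n i. i \<ge> n \<Longrightarrow> c n i = 0"
    "\<And>n i. Suc i < n \<Longrightarrow> c n (Suc i) < c n i"
    "\<And>n x. poly (kummer_poly n b) x = (\<Prod>i<n. 1 - x * c n i)" "\<And>n. (\<Sum>i<n. c n i) = real n / b"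
    by metis
  \<comment> \<open>Zeros are measured in the variable \<open>w = n * x\<close>; this scaling makes
    the sum of reciprocals \<open>1 / b\<close> for every positive \<open>n\<close>.\<close>
  define a where "a n i = c n i / real n" for n i
  have fac: "poly (kummer_poly n b) (w / real n) = (\<Prod>i<n. 1 - w * a n i)" for n w
    by (simp add: c(4) a_def)
  have pos: "a n i > 0" if "i < n" for n i using c(1)[OF that] that by (simp add: a_def)
  have zero: "a n i = 0" if "i \<ge> n" for n i using c(2)[OF that] by (simp add: a_def)
  have less: "a n (Suc i) < a n i" if "Suc i < n" for n i
    using c(3)[OF that] that by (simp add: a_def divide_strict_right_mono)
  have "a n (Suc i) \<le> a n i" for n i
    using less[of i n] pos[of i n] zero[of n i] zero[of n "Suc i"] by (cases "Suc i < n"; cases "i < n") auto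
  then have anti: "a n j \<le> a n i" if "i \<le> j" for n i j
    using that lift_Suc_antimono_le by blast
  have bound: "a n i \<le> (2 / ln 2)\<^sup>2 * (1 / (real i + 1)\<^sup>2)" for n i
  proof (cases "i < n")
    case True
    define y where "y = 1 / a n i"
    have y: "y > 0" using pos[OF True] by (simp add: y_def)
    have "2 ^ Suc i = (\<Prod>j<Suc i. 2 :: real)" by simp
    also have "\<dots> \<le> (\<Prod>j<Suc i. 1 + y * a n j)"
    proof (rule prod_mono)
      fix j assume "j \<in> {..<Suc i}"
      then have "a n i \<le> a n j" by (intro anti) auto
      then have "1 \<le> y * a n j" using pos[OF True] by (simp add: y_def)
      then show "0 \<le> (2::real) \<and> 2 \<le> 1 + y * a n j" by simp
    qed
    also have "\<dots> \<le> (\<Prod>j<n. 1 + y * a n j)"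
      using True pos y by (intro prod_mono2) (auto simp: less_imp_le)
    also have "\<dots> = poly (kummer_poly n b) (- (y / real n))"
      using fac[of n "- y"] by simp
    also have "\<dots> \<le> exp (2 * sqrt y)"
      using poly_kummer_poly_le_exp[OF assms] y by simp
    \<comment> \<open>Logarithms give \<open>(i + 1) * ln 2 \<le> 2 * sqrt (1 / a n i)\<close>;
      squaring produces the constant \<open>(2 / ln 2)\<^sup>2\<close>.\<close>
    finally have "ln (2 ^ Suc i) \<le> ln (exp (2 * sqrt y))"
      by (subst ln_le_cancel_iff) auto
    then have "(real i + 1) * ln 2 \<le> 2 * sqrt y"
      by (simp add: ln_realpow add_ac del: power_Suc)
    then have "((real i + 1) * ln 2)\<^sup>2 \<le> (2 * sqrt y)\<^sup>2"
      by (intro power_mono) auto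
    also have "(2 * sqrt y)\<^sup>2 = 4 / a n i"
      using y by (simp add: power_mult_distrib y_def)
    finally have "(real i + 1)\<^sup>2 * (ln 2)\<^sup>2 * a n i \<le> 4"
      using pos[OF True] by (simp only: power_mult_distrib pos_le_divide_eq)
    then show ?thesis
      by (simp add: power_divide pos_le_divide_eq mult_ac)
  next
    case False
    then show ?thesis by (simp add: zero)
  qed
  show ?thesis
    using that[of a] pos zero less fac bound c(5) by (simp add: a_def flip: sum_divide_distrib)
qed

section \<open>Passage to the limit: zeros of \<open>hyp01\<close> and their reciprocal sum\<close>

lemma hyp01_zeros:
  assumes b: "b \<ge> 1 / 2"
  obtains z :: "nat \<Rightarrow> real" where "strict_mono z" "{w. w > 0 \<and> hyp01 b w = 0} = range z"
    "(\<lambda>k. 1 / z k) sums (1 / b)"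
proof -
  obtain a where a: "\<And>n i. i < n \<Longrightarrow> a n i > 0" "\<And>n i. i \<ge> n \<Longrightarrow> a n i = 0"
    "\<And>n i. Suc i < n \<Longrightarrow> a n (Suc i) < a n i"
    "\<And>n w. poly (kummer_poly n b) (w / real n) = (\<Prod>i<n. 1 - w * a n i)"
    "\<And>n. n > 0 \<Longrightarrow> (\<Sum>i<n. a n i) = 1 / b"
    "\<And>n i. a n i \<le> (2 / ln 2)\<^sup>2 * (1 / (real i + 1)\<^sup>2)"
    using kummer_reciprocal_zeros[OF b] by blast
  define C :: real where "C = (2 / ln 2)\<^sup>2"
  define M where "M i = C * (1 / (real i + 1)\<^sup>2)" for i
  have aM: "a n i \<le> M i" for n i using a(6) by (simp add: M_def C_def)
  have a0: "a n i \<ge> 0" for n i using a(1)[of i n] a(2)[of n i] by (cases "i < n") auto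
  have aSuc: "a n (Suc i) \<le> a n i" for n i
    using a(3)[of i n] a(2)[of n "Suc i"] a0[of n i] by (cases "Suc i < n") auto
  have M0: "M i \<ge> 0" for i by (simp add: M_def C_def)
  have MC: "M i \<le> C" for i
    unfolding M_def by (rule mult_left_le) (auto simp: C_def)
  have M_summable: "summable M"
    unfolding M_def using inverse_squares_sums by (intro summable_mult) (simp add: sums_iff add_ac)
  have bdd: "norm (a n i) \<le> C" for n i
    using order.trans[OF aM MC] a0[of n i] by simp
  obtain \<sigma> where \<sigma>: "strict_mono (\<sigma> :: nat \<Rightarrow> nat)"
      and conv: "\<And>i. i \<in> UNIV \<Longrightarrow> \<exists>l. (\<lambda>m. a (\<sigma> m) i) \<longlonglongrightarrow> l"
    by (rule function_convergent_subsequence[of UNIV a C, OF countableI_type bdd]) blast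
  define l where "l i = lim (\<lambda>m. a (\<sigma> m) i)" for i
  have l: "(\<lambda>m. a (\<sigma> m) i) \<longlonglongrightarrow> l i" for i
    using conv[of i] unfolding l_def by (simp add: convergent_def flip: convergent_LIMSEQ_iff)
  \<comment> \<open>The shift by one ensures \<open>N m > m\<close>, hence \<open>N m > 0\<close>:
    division by \<open>N m\<close> is harmless and the reciprocals sum to \<open>1 / b\<close> for
    every \<open>m\<close>.\<close>
  define N where "N m = \<sigma> (Suc m)" for m
  define A where "A m = a (N m)" for m
  have Nm: "m < N m" for m using seq_suble[OF \<sigma>, of "Suc m"] by (simp add: N_def)
  have N: "filterlim N at_top sequentially"
    using filterlim_subseq[OF \<sigma>] filterlim_compose filterlim_Suc unfolding N_def by blast
  have Al: "(\<lambda>m. A m i) \<longlonglongrightarrow> l i" for i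
    using LIMSEQ_Suc[OF l[of i]] by (simp add: A_def N_def)
  have evN: "eventually (\<lambda>m. N m > K) sequentially" for K
    by (rule eventually_compose_filterlim[OF eventually_gt_at_top N])
  have l0: "l i \<ge> 0" for i by (rule LIMSEQ_le_const[OF Al]) (auto simp: A_def a0)
  have lM: "l i \<le> M i" for i by (rule LIMSEQ_le_const2[OF Al]) (auto simp: A_def aM)
  have lSuc: "l (Suc i) \<le> l i" for i by (rule LIMSEQ_le[OF Al Al]) (auto simp: A_def aSuc)
  then have l_anti: "l j \<le> l i" if "i \<le> j" for i j using that lift_Suc_antimono_le by blast
  have l_summable: "summable l"
    by (rule summable_comparison_test'[OF M_summable]) (use l0 lM in auto)
  have A_sum: "suminf (A m) = 1 / b" for m
    using suminf_finite[of "{..<N m}" "A m"] a(2) a(5)[of "N m"] Nm[of m] by (auto simp: A_def)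
  \<comment> \<open>Tannery's theorem with the summable majorant \<open>M\<close>: no mass of the
    sum is lost in the limit.\<close>
  have l_sum: "suminf l = 1 / b"
  proof -
    have "(\<lambda>m. suminf (\<lambda>i. A m i)) \<longlonglongrightarrow> suminf l"
      by (rule conjunct2[OF conjunct2[OF tannerys_theorem[where M = M]]])
        (use Al M_summable aM a0 in \<open>auto simp: A_def intro!: always_eventually\<close>)
    then show ?thesis by (simp add: A_sum LIMSEQ_const_iff)
  qed
  \<comment> \<open>The limit is taken through the coefficients of the polynomials, not factor by
    factor.\<close>
  have prod_lim: "(\<lambda>m. \<Prod>i<N m. 1 - w * A m i) \<longlonglongrightarrow> hyp01 b w" for w
  proof -
    have "real (N m) * (w / real (N m)) = w" for m using Nm[of m] by simp
    then have "(\<lambda>m. poly (kummer_poly (N m) b) (w / real (N m))) \<longlonglongrightarrow> hyp01 b w"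
      by (intro poly_kummer_poly_tendsto b N) simp
    then show ?thesis by (simp add: a(4) A_def)
  qed
  have prod_split: "(\<Prod>i<n. f i) = (\<Prod>i<K. f i) * (\<Prod>i\<in>{K..<n}. f i)" if "K \<le> n" for K n and f :: "nat \<Rightarrow> real"
    using that by (simp add: lessThan_atLeast0 prod.atLeastLessThan_concat)

  \<comment> \<open>If \<open>l K = 0\<close>, only the first \<open>K\<close> limits can be
    nonzero. Then \<open>hyp01 b (- y)\<close> would grow at most like \<open>y ^ K\<close>,
    although its series, with nonnegative terms, contains a positive multiple of
    \<open>y ^ (K + 1)\<close>.\<close>
  have l_pos: "l K > 0" for K
  proof (rule ccontr)
    assume "\<not> l K > 0"
    then have lK: "l i = 0" if "i \<ge> K" for i using l_anti[OF that] l0[of i] by simp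
    have sumK: "(\<Sum>i<K. l i) = 1 / b"
      using suminf_finite[of "{..<K}" l] lK l_sum by auto
    \<comment> \<open>The first \<open>K\<close> factors converge. The others are bounded by the
      exponential of \<open>y\<close> times the tail sum, which tends to 0 because the first
      \<open>K\<close> limits already add up to \<open>1 / b\<close>.\<close>
    have "hyp01 b (- y) \<le> (\<Prod>i<K. 1 + y * l i)" if "y \<ge> 0" for y
    proof (rule LIMSEQ_le)
      show "(\<lambda>m. \<Prod>i<N m. 1 - (- y) * A m i) \<longlonglongrightarrow> hyp01 b (- y)" by (rule prod_lim)
      have "(\<lambda>m. (\<Prod>i<K. 1 + y * A m i) * exp (y * (1 / b - (\<Sum>i<K. A m i))))
          \<longlonglongrightarrow> (\<Prod>i<K. 1 + y * l i) * exp (y * (1 / b - (\<Sum>i<K. l i)))"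
        by (intro tendsto_intros Al)
      then show "(\<lambda>m. (\<Prod>i<K. 1 + y * A m i) * exp (y * (1 / b - (\<Sum>i<K. A m i))))
          \<longlonglongrightarrow> (\<Prod>i<K. 1 + y * l i)" by (simp add: sumK)
      have "(\<Prod>i<N m. 1 - (- y) * A m i) \<le> (\<Prod>i<K. 1 + y * A m i) * exp (y * (1 / b - (\<Sum>i<K. A m i)))"
        if "m \<ge> K" for m
      proof -
        have KN: "K \<le> N m" using that Nm[of m] by simp
        have "(\<Sum>i<N m. A m i) = (\<Sum>i<K. A m i) + (\<Sum>i\<in>{K..<N m}. A m i)"
          using KN by (simp add: lessThan_atLeast0 sum.atLeastLessThan_concat)
        then have tail: "(\<Sum>i\<in>{K..<N m}. A m i) = 1 / b - (\<Sum>i<K. A m i)"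
          using a(5)[of "N m"] Nm[of m] by (simp add: A_def)
        have "(\<Prod>i\<in>{K..<N m}. 1 + y * A m i) \<le> exp (\<Sum>i\<in>{K..<N m}. y * A m i)"
          by (rule prod_le_exp_sum) (use \<open>y \<ge> 0\<close> a0 in \<open>auto simp: A_def\<close>)
        then have "(\<Prod>i\<in>{K..<N m}. 1 + y * A m i) \<le> exp (y * (1 / b - (\<Sum>i<K. A m i)))"
          by (simp only: tail flip: sum_distrib_left)
        then have "(\<Prod>i<K. 1 + y * A m i) * (\<Prod>i\<in>{K..<N m}. 1 + y * A m i)
            \<le> (\<Prod>i<K. 1 + y * A m i) * exp (y * (1 / b - (\<Sum>i<K. A m i)))"
          using \<open>y \<ge> 0\<close> a0 by (intro mult_left_mono prod_nonneg) (auto simp: A_def)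
        then show ?thesis by (simp add: prod_split[OF KN])
      qed
      then show "\<exists>m0. \<forall>m\<ge>m0. (\<Prod>i<N m. 1 - (- y) * A m i) \<le>
          (\<Prod>i<K. 1 + y * A m i) * exp (y * (1 / b - (\<Sum>i<K. A m i)))" by blast
    qed
    moreover have "(\<Prod>i<K. 1 + y * l i) \<le> (y * (1 + C)) ^ K" if "y \<ge> 1" for y
    proof -
      have "(\<Prod>i<K. 1 + y * l i) \<le> (\<Prod>i<K. y * (1 + C))"
      proof (rule prod_mono)
        fix i
        have "y * l i \<le> y * C" using that l0 order.trans[OF lM MC] by (intro mult_left_mono) auto
        moreover have "y * l i \<ge> 0" using that l0[of i] by simp
        ultimately show "0 \<le> 1 + y * l i \<and> 1 + y * l i \<le> y * (1 + C)"
          using that by (simp only: distrib_left) linarith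
      qed
      then show ?thesis by simp
    qed
    moreover have "y ^ Suc K / (fact (Suc K) * pochhammer b (Suc K)) \<le> hyp01 b (- y)" if "y \<ge> 0" for y
    proof -
      have "pochhammer b k > 0" for k using b by (intro pochhammer_pos) auto
      then have "0 \<le> (- (- y)) ^ k / (fact k * pochhammer b k)" for k
        using that by (simp add: less_imp_le)
      then show ?thesis
        using sum_le_suminf[OF summable_hyp01[OF b, of "- y"], of "{Suc K}"]
        by (simp add: hyp01_def del: fact_Suc pochhammer_Suc power_Suc)
    qed
    ultimately have le: "y ^ Suc K / (fact (Suc K) * pochhammer b (Suc K)) \<le> (y * (1 + C)) ^ K" if "y \<ge> 1" for y
      using that by (meson order.trans zero_le_one)
    define D where "D = (1 + C) ^ K * (fact (Suc K) * pochhammer b (Suc K))"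
    have pos: "fact (Suc K) * pochhammer b (Suc K) > 0"
      using pochhammer_pos[of b "Suc K"] b by simp
    have "y \<le> D" if "y \<ge> 1" for y
    proof -
      have "y ^ Suc K \<le> (y * (1 + C)) ^ K * (fact (Suc K) * pochhammer b (Suc K))"
        using le[OF that] pos by (simp only: pos_divide_le_eq)
      then have "y ^ K * y \<le> y ^ K * D"
        by (simp only: D_def power_mult_distrib power_Suc2 mult.assoc)
      then show ?thesis using that by simp
    qed
    from this[of "max 1 (D + 1)"] show False by simp
  qed

  have root: "poly (kummer_poly (N m) b) (1 / A m i / real (N m)) = 0" if "i < N m" for i m
    unfolding a(4) using a(1)[OF that] that by (auto simp: A_def intro!: bexI[of _ i])

  \<comment> \<open>The \<open>k\<close>-th zeros of the polynomials, rescaled, converge to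
    \<open>1 / l k\<close>, and locally uniform convergence in the form of
    \<open>poly_kummer_poly_tendsto\<close> passes the value 0 to the limit.\<close>
  have zero: "hyp01 b (1 / l k) = 0" for k
  proof -
    define x where "x m = 1 / A m k / real (N m)" for m
    have "(\<lambda>m. 1 / A m k) \<longlonglongrightarrow> 1 / l k"
      using l_pos[of k] by (intro tendsto_intros Al) auto
    moreover have "real (N m) * x m = 1 / A m k" for m using Nm[of m] by (simp add: x_def)
    ultimately have "(\<lambda>m. poly (kummer_poly (N m) b) (x m)) \<longlonglongrightarrow> hyp01 b (1 / l k)"
      by (intro poly_kummer_poly_tendsto b N) simp
    moreover have "eventually (\<lambda>m. poly (kummer_poly (N m) b) (x m) = 0) sequentially"
      using evN[of k]
    proof eventually_elim
      case (elim m)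
      then show ?case unfolding x_def by (rule root)
    qed
    ultimately show ?thesis
      by (rule LIMSEQ_unique[OF _ tendsto_eventually])
  qed

  text \<open>A double limit point would, by Rolle, be a common zero of \<open>hyp01 b\<close> and \<open>hyp01 (b + 1)\<close>.\<close>
  have less: "l (Suc k) < l k" for k
  proof (rule ccontr)
    assume "\<not> l (Suc k) < l k"
    then have eq: "l (Suc k) = l k" using lSuc[of k] by simp
    have "\<exists>x. Suc k < N m \<longrightarrow> 1 / A m k < real (N m) * x \<and> real (N m) * x < 1 / A m (Suc k) \<and>
        poly (kummer_poly (N m - 1) (b + 1)) x = 0" for m
    proof (cases "Suc k < N m")
      case True
      let ?p = "kummer_poly (N m) b"
      have pos: "A m k > 0" "A m (Suc k) > 0" "real (N m) > 0"
        using True a(1)[of k "N m"] a(1)[of "Suc k" "N m"] by (auto simp: A_def)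
      have "1 / A m k / real (N m) < 1 / A m (Suc k) / real (N m)"
        using a(3)[OF True] pos by (intro divide_strict_right_mono divide_strict_left_mono) (auto simp: A_def)
      from poly_MVT[OF this, of ?p] root[of k m] root[of "Suc k" m] True pos this
      obtain x where x: "1 / A m k / real (N m) < x" "x < 1 / A m (Suc k) / real (N m)" "poly (pderiv ?p) x = 0"
        by auto
      have "?p = kummer_poly (Suc (N m - 1)) b" using True by simp
      then have "poly (kummer_poly (N m - 1) (b + 1)) x = 0"
        using x(3) b pderiv_kummer_poly[of b "N m - 1"] by simp
      then show ?thesis using x pos by (intro exI[of _ x]) (simp add: divide_less_eq less_divide_eq mult_ac)
    qed auto
    then obtain x where x: "\<And>m. Suc k < N m \<Longrightarrow> 1 / A m k < real (N m) * x m"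
      "\<And>m. Suc k < N m \<Longrightarrow> real (N m) * x m < 1 / A m (Suc k)"
      "\<And>m. Suc k < N m \<Longrightarrow> poly (kummer_poly (N m - 1) (b + 1)) (x m) = 0"
      by metis
    define w where "w = 1 / l k"
    have lims: "(\<lambda>m. 1 / A m k) \<longlonglongrightarrow> w" "(\<lambda>m. 1 / A m (Suc k)) \<longlonglongrightarrow> w"
      unfolding w_def using l_pos[of k] eq
      by (auto intro!: tendsto_eq_intros Al)
    have Nx: "(\<lambda>m. real (N m) * x m) \<longlonglongrightarrow> w"
    proof (rule tendsto_sandwich[OF _ _ lims])
      show "eventually (\<lambda>m. 1 / A m k \<le> real (N m) * x m) sequentially"
        using evN[of "Suc k"] by eventually_elim (use x in \<open>auto simp: less_imp_le\<close>)
      show "eventually (\<lambda>m. real (N m) * x m \<le> 1 / A m (Suc k)) sequentially"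
        using evN[of "Suc k"] by eventually_elim (use x in \<open>auto simp: less_imp_le\<close>)
    qed
    \<comment> \<open>The derivative has index \<open>N m - 1\<close>, so the scaling has to change
      from \<open>N m\<close> to \<open>N m - 1\<close>; the ratio of the two tends to 1.\<close>
    have "(\<lambda>m. real (N m) * x m * (1 - 1 / real (N m))) \<longlonglongrightarrow> w * (1 - 0)"
      by (intro tendsto_intros Nx filterlim_compose[OF lim_1_over_n N])
    moreover have "real (N m) * x m * (1 - 1 / real (N m)) = real (N m - 1) * x m" for m
      using Nm[of m] by (simp add: field_simps)
    ultimately have "(\<lambda>m. real (N m - 1) * x m) \<longlonglongrightarrow> w" by simp
    moreover have "filterlim (\<lambda>m. N m - 1) at_top sequentially"
      by (rule filterlim_compose[OF filterlim_minus_const_nat_at_top N])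
    ultimately have "(\<lambda>m. poly (kummer_poly (N m - 1) (b + 1)) (x m)) \<longlonglongrightarrow> hyp01 (b + 1) w"
      using b by (intro poly_kummer_poly_tendsto) auto
    moreover have "eventually (\<lambda>m. poly (kummer_poly (N m - 1) (b + 1)) (x m) = 0) sequentially"
      using evN[of "Suc k"] by eventually_elim (use x in auto)
    ultimately have "hyp01 (b + 1) w = 0"
      by (rule LIMSEQ_unique[OF _ tendsto_eventually])
    then show False
      using hyp01_no_common_zero[OF b _ zero[of k]] l_pos[of k] by (simp add: w_def)
  qed

  \<comment> \<open>If \<open>w\<close> differs from every \<open>1 / l k\<close>, the first
    \<open>K\<close> factors have a nonzero limit, while the product of the rest stays at least
    \<open>1 / 2\<close>; hence \<open>hyp01 b w\<close> is nonzero.\<close>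
  have surj: "\<exists>k. w = 1 / l k" if w: "w > 0" "hyp01 b w = 0" for w
  proof (rule ccontr)
    assume "\<nexists>k. w = 1 / l k"
    then have ne: "1 - w * l k \<noteq> 0" for k
      using l_pos[of k] eq_divide_eq[of w 1 "l k"] by auto
    \<comment> \<open>\<open>K\<close> is chosen so that \<open>w\<close> times the tail of
      \<open>M\<close> is below \<open>1 / 2\<close>, which bounds the tail sums for all
      \<open>m\<close> at once.\<close>
    obtain K where "norm (\<Sum>i. M (i + K)) < 1 / (2 * w)"
      using suminf_exist_split[OF _ M_summable, of "1 / (2 * w)"] w(1) by auto
    then have MK: "(\<Sum>i. M (i + K)) < 1 / (2 * w)" by simp
    have tail: "(\<Sum>i\<in>{K..<n}. w * A m i) \<le> 1 / 2" for n m
    proof -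
      have "(\<Sum>i\<in>{K..<n}. A m i) \<le> (\<Sum>i\<in>{K..<n}. M i)" by (intro sum_mono) (simp add: A_def aM)
      also have "\<dots> = (\<Sum>i\<in>{..<n - K}. M (i + K))"
        by (rule sum.reindex_bij_witness[of _ "\<lambda>i. i + K" "\<lambda>i. i - K"]) auto
      also have "\<dots> \<le> (\<Sum>i. M (i + K))"
        using M0 M_summable by (intro sum_le_suminf) auto
      finally have "(\<Sum>i\<in>{K..<n}. A m i) \<le> 1 / (2 * w)" using MK by simp
      then show ?thesis using w(1) by (simp add: field_simps flip: sum_distrib_left)
    qed
    have "(\<Prod>i<K. \<bar>1 - w * l i\<bar>) * (1 / 2) \<le> \<bar>hyp01 b w\<bar>"
    proof (rule LIMSEQ_le)
      show "(\<lambda>m. (\<Prod>i<K. \<bar>1 - w * A m i\<bar>) * (1 / 2)) \<longlonglongrightarrow> (\<Prod>i<K. \<bar>1 - w * l i\<bar>) * (1 / 2)"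
        by (intro tendsto_intros Al)
      show "(\<lambda>m. \<bar>\<Prod>i<N m. 1 - w * A m i\<bar>) \<longlonglongrightarrow> \<bar>hyp01 b w\<bar>"
        by (intro tendsto_intros prod_lim)
      have "(\<Prod>i<K. \<bar>1 - w * A m i\<bar>) * (1 / 2) \<le> \<bar>\<Prod>i<N m. 1 - w * A m i\<bar>" if "m \<ge> K" for m
      proof -
        have KN: "K \<le> N m" using that Nm[of m] by simp
        have "0 \<le> w * A m i" for i using w(1) a0 by (simp add: A_def)
        moreover have "w * A m i \<le> 1" if "i \<in> {K..<N m}" for i
          using member_le_sum[of i "{K..<N m}" "\<lambda>i. w * A m i"] that tail[of m "N m"] w(1) a0
          by (auto simp: A_def)
        ultimately have "1 - (\<Sum>i\<in>{K..<N m}. w * A m i) \<le> (\<Prod>i\<in>{K..<N m}. 1 - w * A m i)"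
          by (intro prod_1_minus_ge) auto
        then have "1 / 2 \<le> \<bar>\<Prod>i\<in>{K..<N m}. 1 - w * A m i\<bar>" using tail[of m "N m"] by linarith
        then have "(\<Prod>i<K. \<bar>1 - w * A m i\<bar>) * (1 / 2)
            \<le> (\<Prod>i<K. \<bar>1 - w * A m i\<bar>) * \<bar>\<Prod>i\<in>{K..<N m}. 1 - w * A m i\<bar>"
          by (intro mult_left_mono prod_nonneg) auto
        then show ?thesis by (simp add: prod_split[OF KN] abs_mult abs_prod)
      qed
      then show "\<exists>m0. \<forall>m\<ge>m0. (\<Prod>i<K. \<bar>1 - w * A m i\<bar>) * (1 / 2) \<le> \<bar>\<Prod>i<N m. 1 - w * A m i\<bar>" by blast
    qed
    moreover have "(\<Prod>i<K. \<bar>1 - w * l i\<bar>) > 0" using ne by (intro prod_pos) auto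
    ultimately show False using w by simp
  qed

  show ?thesis
  proof (rule that)
    show "strict_mono (\<lambda>k. 1 / l k)"
      using less l_pos by (auto simp: strict_mono_Suc_iff intro!: divide_strict_left_mono)
    show "{w. w > 0 \<and> hyp01 b w = 0} = range (\<lambda>k. 1 / l k)"
      using surj zero l_pos by auto
    show "(\<lambda>k. 1 / (1 / l k)) sums (1 / b)"
      using l_summable l_sum by (simp add: sums_iff)
  qed
qed

section \<open>Transfer to the zeros of the Bessel function\<close>

text \<open>Termwise, by \<open>Gamma (k + \<nu> + 1) = Gamma (\<nu> + 1) * pochhammer (\<nu> + 1)
  k\<close>. The prefactor is nonzero, so positive zeros correspond under
  \<open>w = x\<^sup>2 / 4\<close>.\<close>

lemma bessel_J_conv_hyp01:
  assumes "\<nu> > - 1 / 2" "x > 0"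
  shows "bessel_J \<nu> x = (x / 2) powr \<nu> / Gamma (\<nu> + 1) * hyp01 (\<nu> + 1) (x\<^sup>2 / 4)"
proof -
  have eq: "(- 1) ^ k / (fact k * Gamma (real k + \<nu> + 1)) * (x / 2) powr (2 * real k + \<nu>) =
      (x / 2) powr \<nu> / Gamma (\<nu> + 1) * ((- (x\<^sup>2 / 4)) ^ k / (fact k * pochhammer (\<nu> + 1) k))" for k
  proof -
    have "\<nu> + 1 \<notin> \<int>\<^sub>\<le>\<^sub>0" using assms nonpos_Ints_nonpos[of "\<nu> + 1"] by auto
    then have "Gamma (real k + \<nu> + 1) = Gamma (\<nu> + 1) * pochhammer (\<nu> + 1) k"
      using assms by (simp add: pochhammer_Gamma Gamma_eq_zero_iff add_ac)
    moreover have "(x / 2) powr (2 * real k + \<nu>) = (x / 2) powr \<nu> * (x\<^sup>2 / 4) ^ k"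
      using assms powr_realpow[of "x / 2" "2 * k"] by (simp add: powr_add power_mult power_divide)
    ultimately show ?thesis by (simp add: power_minus[of "x\<^sup>2 / 4"] mult_ac)
  qed
  then show ?thesis
    unfolding bessel_J_def hyp01_def eq
    by (intro suminf_mult summable_hyp01) (use assms in simp)
qed

text \<open>Exactly \<open>z 0, ..., z k\<close> lie at or below \<open>z k\<close>, so the
  cardinality condition singles out \<open>z k\<close>. The enumeration \<open>z\<close> starts at 0
  and \<open>bessel_J_zero\<close> at 1, whence \<open>Suc k\<close>.\<close>

lemma bessel_J_zero_eq:
  assumes "strict_mono z" "bessel_J_zeros \<nu> = range z"
  shows "bessel_J_zero \<nu> (Suc k) = z k"
proof -
  have card: "card {x \<in> bessel_J_zeros \<nu>. x \<le> z i} = Suc i" for i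
  proof -
    have "{x \<in> bessel_J_zeros \<nu>. x \<le> z i} = z ` {..i}"
      using assms by (auto simp: strict_mono_less_eq)
    then show ?thesis
      using assms(1) by (simp add: card_image strict_mono_imp_inj_on inj_on_subset)
  qed
  show ?thesis
    unfolding bessel_J_zero_def
  proof (rule the_equality)
    show "z k \<in> bessel_J_zeros \<nu> \<and> card {x \<in> bessel_J_zeros \<nu>. x \<le> z k} = Suc k"
      using card assms by auto
    show "y = z k" if "y \<in> bessel_J_zeros \<nu> \<and> card {x \<in> bessel_J_zeros \<nu>. x \<le> y} = Suc k" for y
      using that card assms(2) by auto
  qed
qed

theorem corollary3p2:
  fixes \<alpha> \<nu> :: real
  assumes "\<alpha> > 0" and "\<nu> = \<alpha> - 1 / 2"
  shows "(\<lambda>k. 1 / (bessel_J_zero \<nu> (Suc k))\<^sup>2) sums (1 / (4 * (\<nu> + 1)))"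
proof -
  have \<nu>: "\<nu> > - 1 / 2" using assms by simp
  obtain z where z: "strict_mono z" "{w. w > 0 \<and> hyp01 (\<nu> + 1) w = 0} = range z"
    "(\<lambda>k. 1 / z k) sums (1 / (\<nu> + 1))"
    using hyp01_zeros[of "\<nu> + 1"] \<nu> by auto
  have G: "Gamma (\<nu> + 1) \<noteq> 0" using \<nu> by (intro less_imp_neq[THEN not_sym] Gamma_real_pos) simp
  have z_pos: "z k > 0" for k using z(2) by auto
  have "bessel_J_zeros \<nu> = range (\<lambda>k. 2 * sqrt (z k))"
  proof (intro equalityI subsetI)
    fix x assume "x \<in> bessel_J_zeros \<nu>"
    then have "x > 0" "hyp01 (\<nu> + 1) (x\<^sup>2 / 4) = 0"
      using \<nu> G by (auto simp: bessel_J_zeros_def bessel_J_conv_hyp01)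
    then have "x\<^sup>2 / 4 \<in> range z" using z(2) by auto
    then obtain k where "z k = (x / 2)\<^sup>2" by (auto simp: power_divide)
    then have "x = 2 * sqrt (z k)" using \<open>x > 0\<close> by simp
    then show "x \<in> range (\<lambda>k. 2 * sqrt (z k))" by blast
  next
    fix x assume "x \<in> range (\<lambda>k. 2 * sqrt (z k))"
    then obtain k where x: "x = 2 * sqrt (z k)" by auto
    have "hyp01 (\<nu> + 1) (z k) = 0" using z(2) by auto
    then show "x \<in> bessel_J_zeros \<nu>"
      using z_pos[of k] \<nu> by (simp add: bessel_J_zeros_def bessel_J_conv_hyp01 x power_mult_distrib)
  qed
  moreover have "strict_mono (\<lambda>k. 2 * sqrt (z k))"
    using z(1) by (simp add: strict_mono_def)
  ultimately have zero: "bessel_J_zero \<nu> (Suc k) = 2 * sqrt (z k)" for k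
    by (rule bessel_J_zero_eq[rotated])
  \<comment> \<open>The square of a Bessel zero \<open>2 * sqrt (z k)\<close> is
    \<open>4 * z k\<close>, which accounts for the factor 4.\<close>
  have "(\<lambda>k. 1 / z k / 4) sums (1 / (\<nu> + 1) / 4)" by (intro sums_divide z)
  then show ?thesis
    using z_pos by (simp add: zero power_mult_distrib less_imp_le mult_ac)
qed

end
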